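(* Let $v\in S_n$ and let $A$ be any $p\times p$ ($p\ge2$) minor of $Z^{(v)}$ with rows $i_1<\dots<i_p$ and columns $j_1<\dots<j_p$ (with respect to $Z^{(v)}$). Then $A$ has a zero row or a zero column if and only if at least one of the following holds: (1) $v(j_k)<i_1$ for some $1\le k\le p$. (2) $v^{-1}(i_l)<j_1$ for some $1\le l\le p$. (3) $\min\{v(j_k)\mid 1\le k\le p\}\ge i_1$ and there exists $k\in\{1,\dots,p\}$ such that either $i_s<v(j_k)<i_{s+1}$ for some $1\le s\le p-1$ and $v^{-1}(i_\xi)<j_k$ for all $1\le\xi\le s$, or $v(j_k)>i_p$ and $v^{-1}(i_\xi)<j_k$ for all $1\le\xi\le p$. (4) $\min\{v^{-1}(i_s)\mid1\le s\le p\}\ge j_1$ and there exists $s\in\{1,\dots,p\}$ such that either $j_\alpha<v^{-1}(i_s)<j_{\alpha+1}$ for some $1\le\alpha\le p-1$ and $v(j_\beta)<i_s$ for all $1\le\beta\le\alpha$, or $v^{-1}(i_s)>j_p$ and $v(j_\beta)<i_s$ for all $1\le\beta\le p$. Here (1) and (3) are the conditions for when there is a zero column, and (2) and (4) are the conditions for when there is a zero row.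
   Context: Rows of $n\times n$ matrices are numbered from bottom to top and columns from left to right. In this statement the convention is that $v(j)$ denotes the row number, counted from the bottom, of the entry $1$ in column $j$ of $Z^{(v)}$. So $Z^{(v)}$ is the $n\times n$ matrix whose entry in row $i$ (from the bottom) and column $j$ is: $1$ if $i=v(j)$; $0$ if $i>v(j)$; $0$ if $i=v(j')$ for some $j'<j$; and an indeterminate $z_{ij}$ otherwise. A minor means a square submatrix. *)

theory Defs
  imports
    "HOL-Library.Poly_Mapping"
    "HOL-Combinatorics.Permutations"
    "Jordan_Normal_Form.Matrix"
    "Jordan_Normal_Form.DL_Submatrix"
begin

text \<open>Polynomials over \<open>'a\<close> in indeterminates labelled by pairs of natural numbers:
  a monomial is a finitely supported exponent function, a polynomial a finitely supported
  coefficient function on monomials.\<close>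

type_synonym 'a zpoly = "((nat \<times> nat) \<Rightarrow>\<^sub>0 nat) \<Rightarrow>\<^sub>0 'a"

definition indet :: "nat \<Rightarrow> nat \<Rightarrow> 'a::comm_ring_1 zpoly" where
  "indet i j = Poly_Mapping.single (Poly_Mapping.single (i, j) 1) 1"

text \<open>Here \<open>i\<close> is the row counted from the bottom and \<open>j\<close> the column counted from the left,
  both starting at 1.\<close>

definition Z_entry :: "(nat \<Rightarrow> nat) \<Rightarrow> nat \<Rightarrow> nat \<Rightarrow> 'a::comm_ring_1 zpoly" where
  "Z_entry v i j =
    (if i = v j then 1
     else if i > v j then 0
     else if \<exists>j'. 1 \<le> j' \<and> j' < j \<and> i = v j' then 0
     else indet i j)"

text \<open>Library matrices are indexed from 0, rows from the top; the library row \<open>r\<close> is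
  therefore row \<open>n - r\<close> from the bottom, and the library column \<open>c\<close> is column \<open>c + 1\<close>.\<close>

definition Z_mat :: "nat \<Rightarrow> (nat \<Rightarrow> nat) \<Rightarrow> 'a::comm_ring_1 zpoly mat" where
  "Z_mat n v = mat n n (\<lambda>(r, c). Z_entry v (n - r) (c + 1))"

text \<open>\<open>I\<close> and \<open>J\<close> are sets of row numbers from the bottom and column numbers from the left,
  starting at 1; they are translated to library indices.\<close>

definition minor_at :: "'b mat \<Rightarrow> nat set \<Rightarrow> nat set \<Rightarrow> 'b mat" where
  "minor_at M I J = submatrix M ((\<lambda>i. dim_row M - i) ` I) ((\<lambda>j. j - 1) ` J)"

definition has_zero_row :: "'b::zero mat \<Rightarrow> bool" where
  "has_zero_row M \<longleftrightarrow> (\<exists>r < dim_row M. row M r = 0\<^sub>v (dim_col M))"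

definition has_zero_col :: "'b::zero mat \<Rightarrow> bool" where
  "has_zero_col M \<longleftrightarrow> (\<exists>c < dim_col M. col M c = 0\<^sub>v (dim_row M))"

text \<open>The sequences \<open>i\<close> and \<open>j\<close> are indexed by \<open>{1..p}\<close>.\<close>

definition cond1 :: "(nat \<Rightarrow> nat) \<Rightarrow> nat \<Rightarrow> (nat \<Rightarrow> nat) \<Rightarrow> (nat \<Rightarrow> nat) \<Rightarrow> bool" where
  "cond1 v p i j \<longleftrightarrow> (\<exists>k\<in>{1..p}. v (j k) < i 1)"

definition cond2 :: "(nat \<Rightarrow> nat) \<Rightarrow> nat \<Rightarrow> (nat \<Rightarrow> nat) \<Rightarrow> (nat \<Rightarrow> nat) \<Rightarrow> bool" where
  "cond2 v p i j \<longleftrightarrow> (\<exists>l\<in>{1..p}. Hilbert_Choice.inv v (i l) < j 1)"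

definition cond3 :: "(nat \<Rightarrow> nat) \<Rightarrow> nat \<Rightarrow> (nat \<Rightarrow> nat) \<Rightarrow> (nat \<Rightarrow> nat) \<Rightarrow> bool" where
  "cond3 v p i j \<longleftrightarrow>
    Min {v (j k) | k. k \<in> {1..p}} \<ge> i 1 \<and>
    (\<exists>k\<in>{1..p}.
      (\<exists>s\<in>{1..p-1}. i s < v (j k) \<and> v (j k) < i (s + 1) \<and>
         (\<forall>\<xi>\<in>{1..s}. Hilbert_Choice.inv v (i \<xi>) < j k)) \<or>
      (v (j k) > i p \<and> (\<forall>\<xi>\<in>{1..p}. Hilbert_Choice.inv v (i \<xi>) < j k)))"

definition cond4 :: "(nat \<Rightarrow> nat) \<Rightarrow> nat \<Rightarrow> (nat \<Rightarrow> nat) \<Rightarrow> (nat \<Rightarrow> nat) \<Rightarrow> bool" where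
  "cond4 v p i j \<longleftrightarrow>
    Min {Hilbert_Choice.inv v (i s) | s. s \<in> {1..p}} \<ge> j 1 \<and>
    (\<exists>s\<in>{1..p}.
      (\<exists>\<alpha>\<in>{1..p-1}. j \<alpha> < Hilbert_Choice.inv v (i s) \<and> Hilbert_Choice.inv v (i s) < j (\<alpha> + 1) \<and>
         (\<forall>\<beta>\<in>{1..\<alpha>}. v (j \<beta>) < i s)) \<or>
      (Hilbert_Choice.inv v (i s) > j p \<and> (\<forall>\<beta>\<in>{1..p}. v (j \<beta>) < i s)))"

end

theory Submission
  imports Defs
begin

text \<open>
  The entry of \<open>Z\<close> in row \<open>a\<close> and column \<open>b\<close> vanishes exactly when it lies above the \<open>1\<close> of its
  column or to the right of the \<open>1\<close> of its row, that is, when \<open>v b < a\<close> or \<open>v\<inverse> a < b\<close>. So column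
  \<open>j\<^sub>k\<close> of the minor is zero iff every chosen row \<open>i\<^sub>l\<close> satisfies \<open>v j\<^sub>k < i\<^sub>l\<close> or \<open>v\<inverse> i\<^sub>l < j\<^sub>k\<close>.
  The rows \<open>i\<^sub>l\<close> are increasing and a zero column cannot contain its own \<open>1\<close>, so \<open>v j\<^sub>k\<close> falls below
  all of them, strictly between two consecutive ones, or above all of them. The rows above \<open>v j\<^sub>k\<close>
  meet the first alternative for free, and the rows below it must meet the second. The position
  below all rows gives condition (1), the other two give the two halves of condition (3); this is
  \<open>zero_column_iff_cond1_or_cond3\<close>.

  The vanishing criterion is symmetric under exchanging \<open>v\<close> with \<open>v\<inverse>\<close> and rows with columns. This
  exchange carries conditions (1) and (3) to (2) and (4), so the statement on rows is the statement
  on columns for \<open>v\<inverse>\<close>.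
\<close>

lemma pick_image_lessThan_card:
  assumes "finite I"
  shows "pick I ` {..<card I} = I"
proof (intro equalityI subsetI)
  fix x assume "x \<in> I"
  then have "{a \<in> I. a < x} \<subset> I" by auto
  then have "card {a \<in> I. a < x} < card I" using assms by (rule psubset_card_mono[rotated])
  moreover have "x = pick I (card {a \<in> I. a < x})" using \<open>x \<in> I\<close> by (simp add: pick_card_in_set)
  ultimately show "x \<in> pick I ` {..<card I}" by blast
qed (auto intro: pick_in_set_le)

lemma
  assumes "I \<subseteq> {..<dim_row M}" "J \<subseteq> {..<dim_col M}"
  shows has_zero_col_submatrix_iff:
      "has_zero_col (submatrix M I J) \<longleftrightarrow> (\<exists>c\<in>J. \<forall>r\<in>I. M $$ (r, c) = 0)"
    and has_zero_row_submatrix_iff: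
      "has_zero_row (submatrix M I J) \<longleftrightarrow> (\<exists>r\<in>I. \<forall>c\<in>J. M $$ (r, c) = 0)"
proof -
  have "{r. r < dim_row M \<and> r \<in> I} = I" "{c. c < dim_col M \<and> c \<in> J} = J"
    using assms by auto
  then have sub: "submatrix M I J = mat (card I) (card J) (\<lambda>(a, b). M $$ (pick I a, pick J b))"
    by (simp add: submatrix_def)
  have I: "pick I ` {..<card I} = I" and J: "pick J ` {..<card J} = J"
    using assms by (simp_all add: pick_image_lessThan_card finite_subset)
  have "has_zero_col (submatrix M I J) \<longleftrightarrow>
      (\<exists>b<card J. \<forall>a<card I. M $$ (pick I a, pick J b) = 0)"
    by (auto simp: has_zero_col_def sub vec_eq_iff)
  also have "\<dots> \<longleftrightarrow> (\<exists>c\<in>pick J ` {..<card J}. \<forall>r\<in>pick I ` {..<card I}. M $$ (r, c) = 0)"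
    by auto
  finally show "has_zero_col (submatrix M I J) \<longleftrightarrow> (\<exists>c\<in>J. \<forall>r\<in>I. M $$ (r, c) = 0)"
    by (simp only: I J)
  have "has_zero_row (submatrix M I J) \<longleftrightarrow>
      (\<exists>a<card I. \<forall>b<card J. M $$ (pick I a, pick J b) = 0)"
    by (auto simp: has_zero_row_def sub vec_eq_iff)
  also have "\<dots> \<longleftrightarrow> (\<exists>r\<in>pick I ` {..<card I}. \<forall>c\<in>pick J ` {..<card J}. M $$ (r, c) = 0)"
    by auto
  finally show "has_zero_row (submatrix M I J) \<longleftrightarrow> (\<exists>r\<in>I. \<forall>c\<in>J. M $$ (r, c) = 0)"
    by (simp only: I J)
qed

lemma indet_neq_zero: "indet a b \<noteq> (0 :: 'a::comm_ring_1 zpoly)"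
  by (metis indet_def lookup_single_eq lookup_zero zero_neq_one)

text \<open>The \<open>1\<close> in the row is at column \<open>v\<inverse> a\<close>, so the case of \<open>Z_entry\<close> that looks for a column
  \<open>b' < b\<close> with \<open>a = v b'\<close> asks whether \<open>v\<inverse> a < b\<close>. Putting the entry \<open>1\<close> first in the case
  distinction does no harm: where \<open>a = v b\<close>, both inequalities on the right are equalities.\<close>

lemma Z_entry_eq_0_iff:
  assumes "v permutes {1..n}" "a \<in> {1..n}"
  shows "Z_entry v a b = (0 :: 'a::comm_ring_1 zpoly) \<longleftrightarrow> v b < a \<or> Hilbert_Choice.inv v a < b"
proof -
  have "Hilbert_Choice.inv v a \<in> {1..n}"
    unfolding permutes_in_image[OF permutes_inv[OF assms(1)]] by (rule assms(2))
  then have ge: "1 \<le> Hilbert_Choice.inv v a" by simp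
  have eq: "a = v b' \<longleftrightarrow> Hilbert_Choice.inv v a = b'" for b'
    using permutes_inv_eq[OF assms(1)] by metis
  have ex: "(\<exists>b'. 1 \<le> b' \<and> b' < b \<and> a = v b') \<longleftrightarrow> Hilbert_Choice.inv v a < b"
    unfolding eq using ge by blast
  show ?thesis
  proof (cases "a = v b")
    case True
    then show ?thesis using eq[of b] by (simp add: Z_entry_def)
  next
    case False
    then show ?thesis unfolding Z_entry_def ex by (simp add: indet_neq_zero)
  qed
qed

lemma
  assumes "v permutes {1..n}" "I \<subseteq> {1..n}" "J \<subseteq> {1..n}"
  shows has_zero_col_minor_iff:
      "has_zero_col (minor_at (Z_mat n v :: 'a::comm_ring_1 zpoly mat) I J) \<longleftrightarrow>
        (\<exists>b\<in>J. \<forall>a\<in>I. v b < a \<or> Hilbert_Choice.inv v a < b)"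
    and has_zero_row_minor_iff:
      "has_zero_row (minor_at (Z_mat n v :: 'a::comm_ring_1 zpoly mat) I J) \<longleftrightarrow>
        (\<exists>a\<in>I. \<forall>b\<in>J. v b < a \<or> Hilbert_Choice.inv v a < b)"
proof -
  let ?Z = "Z_mat n v :: 'a zpoly mat"
  have dim: "dim_row ?Z = n" "dim_col ?Z = n" by (simp_all add: Z_mat_def)
  have sub: "(\<lambda>a. n - a) ` I \<subseteq> {..<dim_row ?Z}" "(\<lambda>b. b - 1) ` J \<subseteq> {..<dim_col ?Z}"
    using assms by (fastforce simp: dim)+
  have entry: "?Z $$ (n - a, b - 1) = 0 \<longleftrightarrow> v b < a \<or> Hilbert_Choice.inv v a < b"
    if "a \<in> I" "b \<in> J" for a b
  proof -
    have ab: "a \<in> {1..n}" "b \<in> {1..n}" using that assms by auto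
    then have "?Z $$ (n - a, b - 1) = Z_entry v a b"
      by (simp add: Z_mat_def less_diff_conv2)
    then show ?thesis using Z_entry_eq_0_iff[OF assms(1) ab(1)] by metis
  qed
  show "has_zero_col (minor_at ?Z I J) \<longleftrightarrow> (\<exists>b\<in>J. \<forall>a\<in>I. v b < a \<or> Hilbert_Choice.inv v a < b)"
    unfolding minor_at_def dim(1) has_zero_col_submatrix_iff[OF sub]
    by (simp add: entry del: One_nat_def cong: bex_cong ball_cong)
  show "has_zero_row (minor_at ?Z I J) \<longleftrightarrow> (\<exists>a\<in>I. \<forall>b\<in>J. v b < a \<or> Hilbert_Choice.inv v a < b)"
    unfolding minor_at_def dim(1) has_zero_row_submatrix_iff[OF sub]
    by (simp add: entry del: One_nat_def cong: bex_cong ball_cong)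
qed

text \<open>Three positions of \<open>v (j k)\<close> among the increasing \<open>i l\<close> are possible, as explained above. The
  lemma is stated for an injection \<open>v\<close> and an arbitrary \<open>j\<close>, without mention of a matrix, because
  it is applied a second time with \<open>v\<inverse>\<close> for \<open>v\<close> and with the two sequences exchanged.\<close>

lemma zero_column_iff_cond1_or_cond3:
  fixes v i j :: "nat \<Rightarrow> nat"
  assumes "inj v" "p \<ge> 1" "strict_mono_on {1..p} i"
  shows "(\<exists>k\<in>{1..p}. \<forall>l\<in>{1..p}. v (j k) < i l \<or> Hilbert_Choice.inv v (i l) < j k) \<longleftrightarrow>
    cond1 v p i j \<or> cond3 v p i j"
proof
  assume "\<exists>k\<in>{1..p}. \<forall>l\<in>{1..p}. v (j k) < i l \<or> Hilbert_Choice.inv v (i l) < j k"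
  then obtain k where k: "k \<in> {1..p}"
    and zero: "\<And>l. l \<in> {1..p} \<Longrightarrow> v (j k) < i l \<or> Hilbert_Choice.inv v (i l) < j k" by blast
  have no_one: "v (j k) \<noteq> i l" if "l \<in> {1..p}" for l
    using zero[OF that] inv_f_f[OF assms(1), of "j k"] by auto
  show "cond1 v p i j \<or> cond3 v p i j"
  proof (cases "cond1 v p i j")
    case False
    then have above: "i 1 \<le> v (j k')" if "k' \<in> {1..p}" for k'
      using that by (auto simp: cond1_def not_less)
    have val_set: "{v (j k) |k. k \<in> {1..p}} = (\<lambda>k. v (j k)) ` {1..p}" by auto
    have min: "i 1 \<le> Min {v (j k) |k. k \<in> {1..p}}"
      unfolding val_set using above assms(2) by (subst Min_ge_iff) auto
    \<comment> \<open>\<open>s\<close> is the last chosen row below the \<open>1\<close> of column \<open>j k\<close>.\<close>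
    define S where "S = {l \<in> {1..p}. i l < v (j k)}"
    define s where "s = Max S"
    have "1 \<in> {1..p}" using assms(2) by simp
    then have "1 \<in> S" using above[OF k] no_one[of 1] by (simp add: S_def)
    have "finite S" by (simp add: S_def)
    then have "s \<in> S" unfolding s_def using \<open>1 \<in> S\<close> by (intro Max_in) auto
    then have s: "s \<in> {1..p}" "i s < v (j k)" by (simp_all add: S_def)
    have low: "Hilbert_Choice.inv v (i l) < j k" if "l \<in> {1..s}" for l
    proof -
      have l: "l \<in> {1..p}" using that s(1) by auto
      then have "i l \<le> i s"
        using strict_mono_on_leD[OF assms(3) l s(1)] that by simp
      then show ?thesis using zero[OF l] s(2) by simp
    qed
    have "cond3 v p i j"
    proof (cases "s = p")
      case True
      with s low have "v (j k) > i p \<and> (\<forall>l\<in>{1..p}. Hilbert_Choice.inv v (i l) < j k)"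
        by simp
      with min k show ?thesis unfolding cond3_def by (intro conjI bexI[of _ k] disjI2) simp_all
    next
      case False
      then have s': "s \<in> {1..p-1}" "s + 1 \<in> {1..p}" using s(1) by auto
      have "s + 1 \<notin> S" using Max_ge[OF \<open>finite S\<close>, of "s + 1"] by (auto simp: s_def)
      then have "v (j k) < i (s + 1)" using s'(2) no_one[OF s'(2)] unfolding S_def by auto
      with s(2) low have "i s < v (j k) \<and> v (j k) < i (s + 1) \<and>
          (\<forall>l\<in>{1..s}. Hilbert_Choice.inv v (i l) < j k)"
        by simp
      with min k s'(1) show ?thesis
        unfolding cond3_def by (intro conjI bexI[of _ k] disjI1 bexI[of _ s]) simp_all
    qed
    then show ?thesis ..
  qed simp
next
  have mono: "i l \<le> i l'" if "l \<in> {1..p}" "l' \<in> {1..p}" "l \<le> l'" for l l'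
    using strict_mono_on_leD[OF assms(3)] that by blast
  assume "cond1 v p i j \<or> cond3 v p i j"
  then show "\<exists>k\<in>{1..p}. \<forall>l\<in>{1..p}. v (j k) < i l \<or> Hilbert_Choice.inv v (i l) < j k"
  proof
    assume "cond1 v p i j"
    then obtain k where k: "k \<in> {1..p}" "v (j k) < i 1" by (auto simp: cond1_def)
    have "v (j k) < i l" if "l \<in> {1..p}" for l
      using k(2) mono[of 1 l] that by simp
    then show ?thesis using k(1) by blast
  next
    assume "cond3 v p i j"
    then obtain k where k: "k \<in> {1..p}" and pos:
      "(\<exists>s\<in>{1..p-1}. i s < v (j k) \<and> v (j k) < i (s + 1) \<and>
          (\<forall>l\<in>{1..s}. Hilbert_Choice.inv v (i l) < j k)) \<or>
        (v (j k) > i p \<and> (\<forall>l\<in>{1..p}. Hilbert_Choice.inv v (i l) < j k))"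
      unfolding cond3_def by (elim conjE bexE)
    have "v (j k) < i l \<or> Hilbert_Choice.inv v (i l) < j k" if l: "l \<in> {1..p}" for l
      using pos
    proof (elim disjE bexE conjE)
      fix s assume s: "s \<in> {1..p-1}" "v (j k) < i (s + 1)"
        and low: "\<forall>l\<in>{1..s}. Hilbert_Choice.inv v (i l) < j k"
      show ?thesis
      proof (cases "l \<le> s")
        case True
        then show ?thesis using low l by simp
      next
        case False
        then show ?thesis using s mono[of "s + 1" l] l by simp
      qed
    next
      assume "\<forall>l\<in>{1..p}. Hilbert_Choice.inv v (i l) < j k"
      then show ?thesis using l by simp
    qed
    then show ?thesis using k by blast
  qed
qed

theorem lemma6p1p2:
  fixes n p :: nat and v i j :: "nat \<Rightarrow> nat"
    and A :: "'a::comm_ring_1 zpoly mat"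
  assumes "v permutes {1..n}"
    and "p \<ge> 2"
    and "strict_mono_on {1..p} i" and "i ` {1..p} \<subseteq> {1..n}"
    and "strict_mono_on {1..p} j" and "j ` {1..p} \<subseteq> {1..n}"
    and "A = minor_at (Z_mat n v) (i ` {1..p}) (j ` {1..p})"
  shows "(has_zero_row A \<or> has_zero_col A \<longleftrightarrow>
            cond1 v p i j \<or> cond2 v p i j \<or> cond3 v p i j \<or> cond4 v p i j) \<and>
         (has_zero_col A \<longleftrightarrow> cond1 v p i j \<or> cond3 v p i j) \<and>
         (has_zero_row A \<longleftrightarrow> cond2 v p i j \<or> cond4 v p i j)"
proof -
  let ?w = "Hilbert_Choice.inv v"
  have p: "p \<ge> 1" using assms(2) by simp
  have ww: "Hilbert_Choice.inv ?w = v" by (rule permutes_inv_inv[OF assms(1)])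
  have col: "has_zero_col A \<longleftrightarrow> cond1 v p i j \<or> cond3 v p i j"
    using zero_column_iff_cond1_or_cond3[OF permutes_inj[OF assms(1)] p assms(3), of j]
    by (simp add: assms(7) has_zero_col_minor_iff[OF assms(1,4,6)] del: One_nat_def)
  have "has_zero_row A \<longleftrightarrow> (\<exists>l\<in>{1..p}. \<forall>k\<in>{1..p}. ?w (i l) < j k \<or> v (j k) < i l)"
    by (simp add: assms(7) has_zero_row_minor_iff[OF assms(1,4,6)] disj_commute del: One_nat_def)
  also have "\<dots> \<longleftrightarrow> cond1 ?w p j i \<or> cond3 ?w p j i"
    using zero_column_iff_cond1_or_cond3[OF permutes_inj[OF permutes_inv[OF assms(1)]] p assms(5), of i]
    by (simp add: ww)
  also have "\<dots> \<longleftrightarrow> cond2 v p i j \<or> cond4 v p i j"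
    by (simp add: cond1_def cond2_def cond3_def cond4_def ww)
  finally have "has_zero_row A \<longleftrightarrow> cond2 v p i j \<or> cond4 v p i j" .
  with col show ?thesis by blast
qed

end
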